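(* Let $F_k\in C^1(\Omega)$, $k=1,\dots,l$, with $\Delta(x^0)\neq0$, and let $y_1,\dots,y_{d-l}$ be the solutions, with values in $V$, of the iterated differential system $$\frac{\partial y_1}{\partial t_1}(t_1)=v_1(y_1(t_1)),\quad y_1(0)=x^0,$$ $$\frac{\partial y_j}{\partial t_j}(t_1,\dots,t_j)=v_j(y_j(t_1,\dots,t_j)),\quad y_j(t_1,\dots,t_{j-1},0)=y_{j-1}(t_1,\dots,t_{j-1}),\qquad j=2,\dots,d-l,$$ where $y_j$ is defined on $I_1\times\dots\times I_j$, $I_1,\dots,I_{d-l}$ are closed intervals containing $0$ in their interior, and the fields $v_s$ are those of the context (last $d-l$ components equal to the rows of the identity matrix). Then the last $d-l$ components of $y_{d-l}(t_1,\dots,t_{d-l})$ are $$(t_1+x^0_{l+1},\;t_2+x^0_{l+2},\;\dots,\;t_{d-l}+x^0_d),$$ that is, the first $l$ components of $y_{d-l}$, as functions of $(s_{l+1},\dots,s_d)=(t_1+x^0_{l+1},\dots,t_{d-l}+x^0_d)$, give the unique solution (in the sense of the implicit function theorem) $(x_1,\dots,x_l)=(x_1,\dots,x_l)(s_{l+1},\dots,s_d)$ of the implicit system $F_k(x_1,\dots,x_d)=0$, $k=1,\dots,l$, on $(x^0_{l+1},\dots,x^0_d)+(I_1\times\dots\times I_{d-l})$, i.e. the unique continuous map taking the value $(x_1^0,\dots,x_l^0)$ at $(x^0_{l+1},\dots,x^0_d)$ and satisfying the system there.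
   Context: Setting: $1\le l\le d-1$ are integers, $\Omega\subset\mathbb{R}^d$ is a bounded domain, $x^0=(x^0_1,\dots,x^0_d)\in\Omega$, $F_1,\dots,F_l$ are real valued functions on $\Omega$ and $F_j(x^0)=0$ for $j=1,\dots,l$. Let $A(x)=\left(\frac{\partial F_i}{\partial x_j}(x)\right)_{1\le i,j\le l}$ and $\Delta(x)=\det A(x)$. When $\Delta(x^0)\ne0$, $V\subset\Omega$ denotes an open neighbourhood of $x^0$ on which $\Delta\neq 0$. Vector fields: for $s=1,\dots,d-l$ and $x\in V$, $v_s(x)\in\mathbb{R}^d$ is the unique vector with $v_s(x)\cdot\nabla F_j(x)=0$ for $j=1,\dots,l$ whose last $d-l$ components are the $s$-th row of the identity matrix of $\mathbb{R}^{d-l}$ (the $(l+s)$-th component is $1$ and the other components with index in $\{l+1,\dots,d\}$ are $0$). Each subsystem is an ordinary differential system in $V$ in the variable $t_j$, with $t_1,\dots,t_{j-1}$ as parameters. *)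

theory Defs
  imports "HOL-Analysis.Analysis"
begin

text \<open>
  The space of dimension \<open>d\<close> is \<open>real ^ ('l + 'm)\<close>, with \<open>l = CARD('l)\<close> and \<open>d - l = CARD('m)\<close>;
  the coordinates \<open>Inl i\<close> are the first \<open>l\<close> ones and the coordinates \<open>Inr k\<close> the last \<open>d - l\<close>.
  Index types are nonempty, so \<open>1 \<le> l \<le> d - 1\<close> holds automatically.
\<close>

definition first_comps :: "real ^ ('l::finite + 'm::finite) \<Rightarrow> real ^ 'l" where
  "first_comps x = (\<chi> i. x $ Inl i)"

definition last_comps :: "real ^ ('l::finite + 'm::finite) \<Rightarrow> real ^ 'm" where
  "last_comps x = (\<chi> k. x $ Inr k)"

definition join_comps :: "real ^ 'l \<Rightarrow> real ^ 'm \<Rightarrow> real ^ ('l::finite + 'm::finite)" where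
  "join_comps u s = (\<chi> c. case c of Inl i \<Rightarrow> u $ i | Inr k \<Rightarrow> s $ k)"

definition C1_on :: "'a::real_normed_vector set \<Rightarrow> ('a \<Rightarrow> real) \<Rightarrow> bool" where
  "C1_on S f \<longleftrightarrow> (\<exists>f' :: 'a \<Rightarrow> 'a \<Rightarrow>\<^sub>L real.
     (\<forall>x\<in>S. (f has_derivative blinfun_apply (f' x)) (at x)) \<and> continuous_on S f')"

definition partial_deriv :: "(real ^ 'n::finite \<Rightarrow> real) \<Rightarrow> 'n \<Rightarrow> real ^ 'n \<Rightarrow> real" where
  "partial_deriv f c x = deriv (\<lambda>h. f (x + h *\<^sub>R axis c 1)) 0"

definition grad :: "(real ^ 'n::finite \<Rightarrow> real) \<Rightarrow> real ^ 'n \<Rightarrow> real ^ 'n" where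
  "grad f x = (\<chi> c. partial_deriv f c x)"

definition Delta :: "('l::finite \<Rightarrow> real ^ ('l + 'm::finite) \<Rightarrow> real) \<Rightarrow> real ^ ('l + 'm) \<Rightarrow> real" where
  "Delta F x = det (\<chi> i j. partial_deriv (F i) (Inl j) x)"

text \<open>The description is proper wherever \<open>Delta F x \<noteq> 0\<close>; the field is only used there.\<close>

definition vfield ::
  "('l::finite \<Rightarrow> real ^ ('l + 'm::finite) \<Rightarrow> real) \<Rightarrow> 'm \<Rightarrow> real ^ ('l + 'm) \<Rightarrow> real ^ ('l + 'm)" where
  "vfield F k x = (THE w. (\<forall>i. w \<bullet> grad (F i) x = 0) \<and> last_comps w = row k (mat 1))"

text \<open>
  The map \<open>e\<close> numbers the last \<open>d - l\<close> coordinates by \<open>1, \<dots>, d - l\<close>. A tuple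
  \<open>(t\<^sub>1, \<dots>, t\<^sub>j)\<close> in \<open>I\<^sub>1 \<times> \<dots> \<times> I\<^sub>j\<close> is an extensional function \<open>t \<in> Pi\<^sub>E {1..j} I\<close>, so that
  \<open>y j\<close>, restricted to that set, is a function of exactly \<open>j\<close> real variables. No regularity of
  \<open>y j\<close> in the parameters \<open>t\<^sub>1, \<dots>, t\<^sub>j\<^sub>-\<^sub>1\<close> is required. At an endpoint of \<open>I\<^sub>j\<close> the derivative
  is one-sided.
\<close>

definition iterated_solution ::
  "('l::finite \<Rightarrow> real ^ ('l + 'm::finite) \<Rightarrow> real) \<Rightarrow> (real ^ ('l + 'm)) set \<Rightarrow> real ^ ('l + 'm)
    \<Rightarrow> (nat \<Rightarrow> 'm) \<Rightarrow> (nat \<Rightarrow> real set) \<Rightarrow> (nat \<Rightarrow> (nat \<Rightarrow> real) \<Rightarrow> real ^ ('l + 'm)) \<Rightarrow> bool" where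
  "iterated_solution F V x0 e I y \<longleftrightarrow>
     (\<forall>j\<in>{1..CARD('m)}. \<forall>t\<in>Pi\<^sub>E {1..j} I.
        y j t \<in> V \<and>
        ((\<lambda>\<tau>. y j (t(j := \<tau>))) has_vector_derivative vfield F (e j) (y j t)) (at (t j) within I j)) \<and>
     (\<forall>t\<in>Pi\<^sub>E {1..1} I. t 1 = 0 \<longrightarrow> y 1 t = x0) \<and>
     (\<forall>j\<in>{2..CARD('m)}. \<forall>t\<in>Pi\<^sub>E {1..j - 1} I. y j (t(j := 0)) = y (j - 1) t)"

definition shifted_box ::
  "(nat \<Rightarrow> 'm::finite) \<Rightarrow> (nat \<Rightarrow> real set) \<Rightarrow> real ^ 'm \<Rightarrow> (real ^ 'm) set" where
  "shifted_box e I s0 = {s. \<forall>j\<in>{1..CARD('m)}. s $ e j - s0 $ e j \<in> I j}"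

definition implicit_solution ::
  "('l::finite \<Rightarrow> real ^ ('l + 'm::finite) \<Rightarrow> real) \<Rightarrow> (real ^ ('l + 'm)) set \<Rightarrow> real ^ ('l + 'm)
    \<Rightarrow> (real ^ 'm) set \<Rightarrow> (real ^ 'm \<Rightarrow> real ^ 'l) \<Rightarrow> bool" where
  "implicit_solution F \<Omega> x0 S g \<longleftrightarrow>
     continuous_on S g \<and>
     g (last_comps x0) = first_comps x0 \<and>
     (\<forall>s\<in>S. join_comps (g s) s \<in> \<Omega> \<and> (\<forall>k. F k (join_comps (g s) s) = 0))"

end

theory Submission imports Defs begin

text \<open>
  The fields \<open>v\<^sub>s\<close> are tangent to the level sets of \<open>F\<close>, so the iterated flow stays in
  \<open>Z = {F = 0}\<close>, while its last \<open>d - l\<close> components move at unit speed along the coordinate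
  axes. Hence it is a lift of the parameter box through the projection of \<open>Z\<close> onto the last
  components, which is a local homeomorphism at points of \<open>V\<close> by the inverse function theorem.

  As \<open>F\<close> is only \<open>C\<^sup>1\<close>, the fields are merely continuous and ODE theory gives no continuous
  dependence of the flow on its initial value. Instead, joint continuity is obtained as for
  homotopy lifting: lifts through a local homeomorphism that are continuous on vertical lines
  and on one horizontal slice are continuous. This is applied once for each coordinate direction.
  Two solutions of the implicit system are two lifts of the (connected) box that agree at one point,
  so they coincide.
\<close>

section \<open>Uniqueness and continuity of lifts through a local homeomorphism\<close>

definition local_homeo_at :: "'b::topological_space set \<Rightarrow> ('b \<Rightarrow> 'a::topological_space) \<Rightarrow> 'b \<Rightarrow> bool" where
  "local_homeo_at Z p z \<longleftrightarrow>
     (\<exists>W U q. open W \<and> z \<in> W \<and> open U \<and> homeomorphism (Z \<inter> W) U p q)"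

text \<open>Agreement of \<open>f\<close> and \<open>g\<close> is locally constant on the connected
  set \<open>T\<close>: near a point of agreement both maps lie in a set \<open>W\<close> such that
  \<open>p\<close> is injective on \<open>Z \<inter> W\<close>, and near a point of disagreement
  Hausdorff separation keeps them apart. The local homeomorphism is asked for along \<open>f\<close>
  only.\<close>

lemma lift_unique:
  fixes f g :: "'c::topological_space \<Rightarrow> 'b::t2_space" and p :: "'b \<Rightarrow> 'a::topological_space"
  assumes T: "connected T" and f: "continuous_on T f" and g: "continuous_on T g"
    and fZ: "f ` T \<subseteq> Z" and gZ: "g ` T \<subseteq> Z"
    and loc: "\<And>x. x \<in> T \<Longrightarrow> local_homeo_at Z p (f x)"
    and eq: "\<And>x. x \<in> T \<Longrightarrow> p (f x) = p (g x)"
    and ab: "a \<in> T" "b \<in> T" "f a = g a"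
  shows "f b = g b"
proof (rule connected_induction_simple[where S = T and a = a and P = "\<lambda>x. f x = g x"])
  fix x assume x: "x \<in> T"
  show "\<exists>N. openin (top_of_set T) N \<and> x \<in> N \<and> (\<forall>y\<in>N. \<forall>z\<in>N. f y = g y \<longrightarrow> f z = g z)"
  proof (cases "f x = g x")
    case True
    obtain W U q where W: "open W" "f x \<in> W" "homeomorphism (Z \<inter> W) U p q"
      using loc[OF x] unfolding local_homeo_at_def by blast
    have "openin (top_of_set T) ((T \<inter> f -` W) \<inter> (T \<inter> g -` W))"
      using W(1) f g by (intro openin_Int continuous_openin_preimage_gen)
    moreover have "f z = g z" if "z \<in> (T \<inter> f -` W) \<inter> (T \<inter> g -` W)" for z
      using that W(3) eq[of z] fZ gZ unfolding homeomorphism_def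
      by (metis IntD1 IntD2 IntI image_subset_iff vimageE)
    ultimately show ?thesis using x W(2) True
      by (intro exI[of _ "(T \<inter> f -` W) \<inter> (T \<inter> g -` W)"]) auto
  next
    case False
    then obtain A B where AB: "open A" "open B" "f x \<in> A" "g x \<in> B" "A \<inter> B = {}"
      using hausdorff by metis
    have "openin (top_of_set T) ((T \<inter> f -` A) \<inter> (T \<inter> g -` B))"
      using AB f g by (intro openin_Int continuous_openin_preimage_gen)
    then show ?thesis using x AB
      by (intro exI[of _ "(T \<inter> f -` A) \<inter> (T \<inter> g -` B)"]) auto
  qed
qed (use T ab in auto)

text \<open>Continuity spreads along each vertical line \<open>{a} \<times> J\<close>, starting from
  the slice at \<open>\<tau>\<^sub>0\<close>: on a small product, uniqueness of lifts along vertical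
  segments identifies \<open>Y\<close> with \<open>q \<circ> \<phi>\<close> for a continuous local
  inverse \<open>q\<close> of \<open>p\<close>.\<close>

lemma lift_continuous:
  fixes Y :: "'c::t2_space \<times> real \<Rightarrow> 'b::t2_space" and p :: "'b \<Rightarrow> 'a::topological_space"
  assumes J: "is_interval J" "\<tau>\<^sub>0 \<in> J"
    and \<phi>: "continuous_on (A \<times> J) \<phi>"
    and YZ: "Y ` (A \<times> J) \<subseteq> Z"
    and loc: "\<And>x. x \<in> A \<times> J \<Longrightarrow> local_homeo_at Z p (Y x)"
    and pY: "\<And>x. x \<in> A \<times> J \<Longrightarrow> p (Y x) = \<phi> x"
    and vert: "\<And>a. a \<in> A \<Longrightarrow> continuous_on J (\<lambda>\<tau>. Y (a, \<tau>))"
    and hor: "continuous_on A (\<lambda>a. Y (a, \<tau>\<^sub>0))"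
  shows "continuous_on (A \<times> J) Y"
proof -
  \<comment> \<open>The property carried along \<open>J\<close> is continuity of a single slice,
    which is what \<open>hor\<close> provides at \<open>\<tau>\<^sub>0\<close>.\<close>
  define P where "P a \<tau> \<longleftrightarrow> continuous (at a within A) (\<lambda>a. Y (a, \<tau>))" for a \<tau>
  \<comment> \<open>\<open>N\<close> is chosen before \<open>\<tau>\<^sub>1\<close>: continuity at
    \<open>a\<close> of any one slice with height in \<open>N\<close> gives joint continuity at all
    heights in \<open>N\<close>.\<close>
  have L: "\<exists>N. openin (top_of_set J) N \<and> \<sigma> \<in> N \<and>
      (\<forall>\<tau>\<^sub>1\<in>N. P a \<tau>\<^sub>1 \<longrightarrow> (\<forall>\<tau>\<in>N. continuous (at (a, \<tau>) within A \<times> J) Y))"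
    if a: "a \<in> A" and s: "\<sigma> \<in> J" for a \<sigma>
  proof -
    obtain W U q where W: "open W" "Y (a, \<sigma>) \<in> W" "open U" "homeomorphism (Z \<inter> W) U p q"
      using loc[of "(a, \<sigma>)"] a s unfolding local_homeo_at_def by blast
    have q: "q (p z) = z" "p z \<in> U" if "z \<in> Z" "z \<in> W" for z
      using W(4) that unfolding homeomorphism_def by blast+
    have q': "p (q u) = u" "q u \<in> Z" "q u \<in> W" if "u \<in> U" for u
      using W(4) that unfolding homeomorphism_def by blast+
    have Ya: "Y (a, \<sigma>) \<in> Z" using YZ a s by blast
    have "\<phi> (a, \<sigma>) \<in> U" using q(2)[OF Ya W(2)] pY[of "(a,\<sigma>)"] a s by simp
    moreover have "continuous (at (a, \<sigma>) within A \<times> J) \<phi>"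
      using \<phi> a s by (simp add: continuous_on_eq_continuous_within)
    ultimately obtain O' where O': "open O'" "(a, \<sigma>) \<in> O'" "\<And>x. x \<in> A \<times> J \<Longrightarrow> x \<in> O' \<Longrightarrow> \<phi> x \<in> U"
      using W(3) unfolding continuous_within_topological by metis
    obtain O1 O2 where O12: "open O1" "open O2" "(a, \<sigma>) \<in> O1 \<times> O2" "O1 \<times> O2 \<subseteq> O'"
      using open_prod_elim[OF O'(1,2)] by metis
    have "continuous (at \<sigma> within J) (\<lambda>\<tau>. Y (a, \<tau>))"
      using vert[OF a] s by (simp add: continuous_on_eq_continuous_within)
    then obtain O3 where O3: "open O3" "\<sigma> \<in> O3" "\<And>\<tau>. \<tau> \<in> J \<Longrightarrow> \<tau> \<in> O3 \<Longrightarrow> Y (a, \<tau>) \<in> W"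
      using W(1,2) unfolding continuous_within_topological by metis
    have "open (O2 \<inter> O3)" "\<sigma> \<in> O2 \<inter> O3" using O12 O3 by auto
    then obtain r where r: "r > 0" "ball \<sigma> r \<subseteq> O2 \<inter> O3"
      by (meson openE)
    \<comment> \<open>\<open>N\<close> is an interval, hence connected, and small enough that
      \<open>Y (a, \<rho>)\<close> stays in \<open>W\<close> for every \<open>\<rho>\<close> in
      it.\<close>
    define N where "N = J \<inter> ball \<sigma> r"
    have N: "connected N"
      unfolding N_def using J(1) by (intro convex_connected convex_Int) (auto simp: is_interval_convex)
    have "continuous (at (a, \<tau>) within A \<times> J) Y"
      if t1: "\<tau>\<^sub>1 \<in> N" and P1: "P a \<tau>\<^sub>1" and t: "\<tau> \<in> N" for \<tau>\<^sub>1 \<tau>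
    proof -
      have "Y (a, \<tau>\<^sub>1) \<in> W" using t1 r O3 unfolding N_def by auto
      then obtain O4 where O4: "open O4" "a \<in> O4" "\<And>b. b \<in> A \<Longrightarrow> b \<in> O4 \<Longrightarrow> Y (b, \<tau>\<^sub>1) \<in> W"
        using P1 W(1) unfolding P_def continuous_within_topological by metis
      \<comment> \<open>Unlike \<open>N\<close>, the set \<open>B\<close> may depend on
        \<open>\<tau>\<^sub>1\<close>: \<open>O1\<close> keeps \<open>\<phi>\<close> in
        \<open>U\<close> over \<open>B \<times> N\<close>, while \<open>O4\<close> puts
        \<open>Y (b, \<tau>\<^sub>1)\<close> in \<open>W\<close>, where \<open>q\<close> inverts
        \<open>p\<close>.\<close>
      define B where "B = A \<inter> (O1 \<inter> O4)"
      have \<phi>U: "\<phi> (b, \<rho>) \<in> U" if "b \<in> B" "\<rho> \<in> N" for b \<rho>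
      proof -
        have "(b, \<rho>) \<in> O1 \<times> O2" "(b, \<rho>) \<in> A \<times> J" using that r unfolding B_def N_def by auto
        then show ?thesis using O'(3) O12(4) by blast
      qed
      have contq: "continuous_on (B \<times> N) (\<lambda>x. q (\<phi> x))"
        by (rule continuous_on_compose2[of U q]) 
          (use W(4) \<phi> \<phi>U in \<open>auto simp: homeomorphism_def B_def N_def elim!: continuous_on_subset\<close>)
      \<comment> \<open>Both sides lift the same vertical segment over the connected set
        \<open>N\<close> and agree at height \<open>\<tau>\<^sub>1\<close>.\<close>
      have eq: "Y (b, \<rho>) = q (\<phi> (b, \<rho>))" if b: "b \<in> B" and \<rho>: "\<rho> \<in> N" for b \<rho>
      proof (rule lift_unique[where T = N and f = "\<lambda>\<rho>. Y (b, \<rho>)" and g = "\<lambda>\<rho>. q (\<phi> (b, \<rho>))" and a = \<tau>\<^sub>1])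
        show "connected N" by fact
        show "continuous_on N (\<lambda>\<rho>. Y (b, \<rho>))"
          using vert[of b] b unfolding B_def N_def by (auto elim: continuous_on_subset)
        show "continuous_on N (\<lambda>\<rho>. q (\<phi> (b, \<rho>)))"
          by (rule continuous_on_compose2[OF contq]) (use b in \<open>auto intro!: continuous_intros\<close>)
        show "(\<lambda>\<rho>. Y (b, \<rho>)) ` N \<subseteq> Z" using YZ b unfolding B_def N_def by auto
        show "(\<lambda>\<rho>. q (\<phi> (b, \<rho>))) ` N \<subseteq> Z" using \<phi>U[OF b] q' by auto
        show "local_homeo_at Z p (Y (b, \<rho>))" if "\<rho> \<in> N" for \<rho>
          using loc that b unfolding B_def N_def by auto
        show "p (Y (b, \<rho>)) = p (q (\<phi> (b, \<rho>)))" if "\<rho> \<in> N" for \<rho>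
          using pY[of "(b, \<rho>)"] q'[OF \<phi>U[OF b that]] that b unfolding B_def N_def by auto
        have "Y (b, \<tau>\<^sub>1) \<in> W" "Y (b, \<tau>\<^sub>1) \<in> Z" "p (Y (b, \<tau>\<^sub>1)) = \<phi> (b, \<tau>\<^sub>1)"
          using O4 b t1 YZ pY[of "(b, \<tau>\<^sub>1)"] unfolding B_def N_def by auto
        then show "Y (b, \<tau>\<^sub>1) = q (\<phi> (b, \<tau>\<^sub>1))" using q by metis
      qed (use t1 \<rho> in auto)
      have "continuous_on (B \<times> N) Y"
        by (rule continuous_on_eq[OF contq]) (auto simp: eq)
      moreover have at: "(a, \<tau>) \<in> B \<times> N"
        using a t O12 O4 unfolding B_def by auto
      ultimately have "continuous (at (a, \<tau>) within B \<times> N) Y"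
        by (simp add: continuous_on_eq_continuous_within)
      moreover have "at (a, \<tau>) within B \<times> N = at (a, \<tau>) within A \<times> J"
        by (rule at_within_nhd[where S = "(O1 \<inter> O4) \<times> ball \<sigma> r"])
          (use at O12 O4 in \<open>auto simp: B_def N_def intro!: open_Times\<close>)
      ultimately show ?thesis by simp
    qed
    moreover have "openin (top_of_set J) N" "\<sigma> \<in> N"
      using r s unfolding N_def by (auto simp: openin_open)
    ultimately show ?thesis by blast
  qed
  \<comment> \<open>Joint continuity restricts to slices, so \<open>L\<close> carries
    \<open>P a\<close> from one height in \<open>N\<close> to all the others, as connectedness of
    \<open>J\<close> requires.\<close>
  have slice: "P a \<tau>" if "continuous (at (a, \<tau>) within A \<times> J) Y" "\<tau> \<in> J" for a \<tau>
    unfolding P_def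
  proof (rule continuous_within_compose2[where f = "\<lambda>b. (b, \<tau>)" and g = Y])
    show "continuous (at a within A) (\<lambda>b. (b, \<tau>))" by (intro continuous_intros)
    show "continuous (at (a, \<tau>) within (\<lambda>b. (b, \<tau>)) ` A) Y"
      using that by (blast intro: continuous_within_subset)
  qed
  have P: "P a \<tau>" if a: "a \<in> A" and t: "\<tau> \<in> J" for a \<tau>
  proof (rule connected_induction_simple[where S = J and a = \<tau>\<^sub>0])
    show "connected J" using J(1) by (simp add: is_interval_connected)
    show "P a \<tau>\<^sub>0" using hor a unfolding P_def by (simp add: continuous_on_eq_continuous_within)
    fix \<sigma> assume "\<sigma> \<in> J"
    from L[OF a this] show "\<exists>N. openin (top_of_set J) N \<and> \<sigma> \<in> N \<and> (\<forall>x\<in>N. \<forall>y\<in>N. P a x \<longrightarrow> P a y)"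
      using slice by (meson openin_imp_subset subsetD)
  qed (use J t in auto)
  then show ?thesis
    unfolding continuous_on_eq_continuous_within using L by blast
qed

section \<open>Splitting of the coordinates, and the gradient\<close>

lemma sum_UNIV_Plus:
  fixes f :: "'l::finite + 'm::finite \<Rightarrow> 'a::comm_monoid_add"
  shows "(\<Sum>c\<in>UNIV. f c) = (\<Sum>i\<in>UNIV. f (Inl i)) + (\<Sum>k\<in>UNIV. f (Inr k))"
  using sum.Plus[of "UNIV :: 'l set" "UNIV :: 'm set" f] by simp

lemma comps_simps [simp]:
  "first_comps (join_comps u s) = u" "last_comps (join_comps u s) = s"
  "join_comps (first_comps x) (last_comps x) = x"
  by (auto simp: first_comps_def last_comps_def join_comps_def vec_eq_iff split: sum.split)

lemma linear_first_comps: "linear first_comps" and linear_last_comps: "linear last_comps"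
  by (auto intro!: linearI simp: first_comps_def last_comps_def vec_eq_iff)

lemma continuous_on_join_comps:
  assumes "continuous_on S f" "continuous_on S g"
  shows "continuous_on S (\<lambda>x. join_comps (f x) (g x))"
proof -
  have "continuous_on S (\<lambda>x. case c of Inl i \<Rightarrow> f x $ i | Inr k \<Rightarrow> g x $ k)" for c
    using assms by (cases c) (auto intro!: continuous_intros)
  then show ?thesis unfolding join_comps_def by (intro continuous_intros)
qed

lemma has_derivative_join_comps:
  fixes f :: "'a::real_normed_vector \<Rightarrow> real ^ 'l::finite" and g :: "'a \<Rightarrow> real ^ 'm::finite"
  assumes "(f has_derivative f') (at x)" "(g has_derivative g') (at x)"
  shows "((\<lambda>x. join_comps (f x) (g x)) has_derivative (\<lambda>h. join_comps (f' h) (g' h))) (at x)"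
proof (subst has_derivative_componentwise_within, intro ballI)
  fix b :: "real ^ ('l + 'm)" assume "b \<in> Basis"
  then obtain c where b: "b = axis c 1" by (auto simp: Basis_vec_def)
  show "((\<lambda>x. join_comps (f x) (g x) \<bullet> b) has_derivative (\<lambda>h. join_comps (f' h) (g' h) \<bullet> b)) (at x)"
    unfolding b join_comps_def using assms
    by (cases c) (auto simp: inner_axis intro!: bounded_linear.has_derivative[OF bounded_linear_vec_nth])
qed

text \<open>Connects \<open>grad\<close>, built from one-variable \<open>deriv\<close>, with the
  total derivative: the chain rule along coordinate lines gives the values on the axis vectors, and
  linearity gives the rest.\<close>

lemma derivative_eq_grad:
  fixes f :: "real ^ 'n::finite \<Rightarrow> real"
  assumes "(f has_derivative f') (at x)"
  shows "f' h = h \<bullet> grad f x"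
proof -
  interpret f': linear f' using assms by (simp add: has_derivative_linear)
  have "partial_deriv f c x = f' (axis c 1)" for c
  proof -
    have "((\<lambda>h. x + h *\<^sub>R axis c 1) has_derivative (\<lambda>h. h *\<^sub>R axis c 1)) (at (0::real))"
      by (auto intro!: derivative_eq_intros)
    moreover have "(f has_derivative f') (at (x + 0 *\<^sub>R axis c 1))" using assms by simp
    ultimately have "((\<lambda>h. f (x + h *\<^sub>R axis c 1)) has_derivative (\<lambda>h. f' (h *\<^sub>R axis c 1))) (at 0)"
      by (rule has_derivative_compose)
    then have "((\<lambda>h. f (x + h *\<^sub>R axis c 1)) has_field_derivative f' (axis c 1)) (at 0)"
      by (simp add: has_field_derivative_def f'.scaleR mult.commute[of _ "f' _"] fun_eq_iff cong: if_cong)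
    then show ?thesis unfolding partial_deriv_def by (rule DERIV_imp_deriv)
  qed
  then have "grad f x $ c = f' (axis c 1)" for c by (simp add: grad_def)
  moreover have "f' h = f' (\<Sum>c\<in>UNIV. h $ c *\<^sub>R axis c 1)"
    using basis_expansion[of h] by (simp add: scalar_mult_eq_scaleR)
  ultimately show ?thesis
    by (simp add: f'.sum f'.scaleR inner_vec_def)
qed

section \<open>The vector fields and their integral curves\<close>

definition jacobian_first :: "('l::finite \<Rightarrow> real ^ ('l + 'm::finite) \<Rightarrow> real) \<Rightarrow> real ^ ('l + 'm) \<Rightarrow> real ^ 'l ^ 'l" where
  "jacobian_first F x = (\<chi> i j. partial_deriv (F i) (Inl j) x)"

lemma inner_grad:
  fixes F :: "'l::finite \<Rightarrow> real ^ ('l + 'm::finite) \<Rightarrow> real"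
  shows "w \<bullet> grad (F i) x = (jacobian_first F x *v first_comps w) $ i + last_comps w \<bullet> last_comps (grad (F i) x)"
  by (simp add: inner_vec_def sum_UNIV_Plus jacobian_first_def matrix_vector_mult_def grad_def
      first_comps_def last_comps_def mult.commute)

text \<open>Once the last components are fixed to \<open>s\<close>, orthogonality to the gradients
  is a square linear system for the first components, with matrix \<open>jacobian_first F x\<close>
  of determinant \<open>Delta F x\<close>. A general \<open>s\<close> serves two purposes: a row of
  the identity gives the field, and \<open>s = 0\<close> gives injectivity of a derivative in
  \<open>local_homeo_level_set\<close>.\<close>

lemma ex1_vfield:
  fixes F :: "'l::finite \<Rightarrow> real ^ ('l + 'm::finite) \<Rightarrow> real"
  assumes "Delta F x \<noteq> 0"
  shows "\<exists>!w. (\<forall>i. w \<bullet> grad (F i) x = 0) \<and> last_comps w = s"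
proof -
  let ?A = "jacobian_first F x"
  have inv: "invertible ?A" using assms by (simp add: Delta_def jacobian_first_def invertible_det_nz)
  obtain B where B: "?A ** B = mat 1" "B ** ?A = mat 1" using inv unfolding invertible_def by blast
  define b where "b = (\<chi> i. - (s \<bullet> last_comps (grad (F i) x)))"
  have "((\<forall>i. w \<bullet> grad (F i) x = 0) \<and> last_comps w = s) \<longleftrightarrow> w = join_comps (B *v b) s" for w
  proof -
    have "(\<forall>i. w \<bullet> grad (F i) x = 0) \<longleftrightarrow> ?A *v first_comps w = b" if "last_comps w = s"
      unfolding inner_grad that by (simp add: vec_eq_iff b_def eq_neg_iff_add_eq_0)
    also have "?A *v u = b \<longleftrightarrow> u = B *v b" for u
      using B by (metis matrix_vector_mul_assoc matrix_vector_mul_lid)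
    finally show ?thesis by (metis comps_simps)
  qed
  then show ?thesis by simp
qed

lemma vfield_spec:
  fixes F :: "'l::finite \<Rightarrow> real ^ ('l + 'm::finite) \<Rightarrow> real"
  assumes "Delta F x \<noteq> 0"
  shows "vfield F k x \<bullet> grad (F i) x = 0" "last_comps (vfield F k x) = axis k 1"
proof -
  have "row k (mat 1) = (axis k 1 :: real ^ 'm)"
    by (auto simp: row_def mat_def axis_def vec_eq_iff)
  with theI'[OF ex1_vfield[OF assms, of "row k (mat 1)"]]
  show "vfield F k x \<bullet> grad (F i) x = 0" "last_comps (vfield F k x) = axis k 1"
    unfolding vfield_def by auto
qed

text \<open>One leg of the iteration. The chain rule turns the two defining properties of the field
  into a zero derivative for \<open>F i\<close> along the curve and a constant derivative for the
  last components.\<close>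

lemma flow_line:
  fixes F :: "'l::finite \<Rightarrow> real ^ ('l + 'm::finite) \<Rightarrow> real"
  assumes J: "is_interval J" "\<tau>\<^sub>0 \<in> J"
    and \<gamma>: "\<And>\<tau>. \<tau> \<in> J \<Longrightarrow> (\<gamma> has_vector_derivative vfield F k (\<gamma> \<tau>)) (at \<tau> within J)"
    and D: "\<And>\<tau>. \<tau> \<in> J \<Longrightarrow> Delta F (\<gamma> \<tau>) \<noteq> 0"
    and F: "\<And>\<tau>. \<tau> \<in> J \<Longrightarrow> F i differentiable at (\<gamma> \<tau>)"
    and \<tau>: "\<tau> \<in> J"
  shows "F i (\<gamma> \<tau>) = F i (\<gamma> \<tau>\<^sub>0)"
    and "last_comps (\<gamma> \<tau>) = last_comps (\<gamma> \<tau>\<^sub>0) + (\<tau> - \<tau>\<^sub>0) *\<^sub>R axis k 1"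
proof -
  have conv: "convex J" using J by (simp add: is_interval_convex)
  have "((\<lambda>\<tau>. F i (\<gamma> \<tau>)) has_derivative (\<lambda>h. 0)) (at \<sigma> within J)" if s: "\<sigma> \<in> J" for \<sigma>
  proof -
    obtain F' where F': "(F i has_derivative F') (at (\<gamma> \<sigma>))"
      using F[OF s] unfolding differentiable_def by blast
    have "((\<lambda>\<tau>. F i (\<gamma> \<tau>)) has_derivative (\<lambda>h. F' (h *\<^sub>R vfield F k (\<gamma> \<sigma>)))) (at \<sigma> within J)"
      using \<gamma>[OF s] F' unfolding has_vector_derivative_def by (rule has_derivative_compose)
    then show ?thesis by (simp add: derivative_eq_grad[OF F'] vfield_spec(1)[OF D[OF s]])
  qed
  from has_derivative_zero_constant[OF conv this] show "F i (\<gamma> \<tau>) = F i (\<gamma> \<tau>\<^sub>0)"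
    using J \<tau> by metis
  have "((\<lambda>\<tau>. last_comps (\<gamma> \<tau>) - \<tau> *\<^sub>R axis k 1) has_derivative (\<lambda>h. 0)) (at \<sigma> within J)"
    if s: "\<sigma> \<in> J" for \<sigma>
    using vfield_spec(2)[OF D[OF s], of k] \<gamma>[OF s] unfolding has_vector_derivative_def
    by (auto intro!: derivative_eq_intros bounded_linear.has_derivative[OF linear_conv_bounded_linear[THEN iffD1, OF linear_last_comps]]
        simp: linear_scale[OF linear_last_comps])
  from has_derivative_zero_constant[OF conv this]
  have "last_comps (\<gamma> \<tau>) - \<tau> *\<^sub>R axis k 1 = last_comps (\<gamma> \<tau>\<^sub>0) - \<tau>\<^sub>0 *\<^sub>R axis k 1"
    using J \<tau> by metis
  then show "last_comps (\<gamma> \<tau>) = last_comps (\<gamma> \<tau>\<^sub>0) + (\<tau> - \<tau>\<^sub>0) *\<^sub>R axis k 1"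
    by (simp add: algebra_simps)
qed

section \<open>The projection of the zero set as a local homeomorphism\<close>

lemma local_homeo_level_set:
  fixes F :: "'l::finite \<Rightarrow> real ^ ('l + 'm::finite) \<Rightarrow> real"
  assumes \<Omega>: "open \<Omega>" and F: "\<And>i. C1_on \<Omega> (F i)"
    and z: "z \<in> \<Omega>" "\<And>i. F i z = 0" "Delta F z \<noteq> 0"
  shows "local_homeo_at {x \<in> \<Omega>. \<forall>i. F i x = 0} last_comps z"
proof -
  obtain F' where F': "\<And>i x. x \<in> \<Omega> \<Longrightarrow> (F i has_derivative blinfun_apply (F' i x)) (at x)"
      "\<And>i. continuous_on \<Omega> (F' i)"
    using F unfolding C1_on_def by metis
  let ?Z = "{x \<in> \<Omega>. \<forall>i. F i x = 0}"
  \<comment> \<open>\<open>\<Phi>\<close> straightens the zero set: it maps it into the points with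
    vanishing first components and preserves the last components.\<close>
  define \<Phi> where "\<Phi> x = join_comps (\<chi> i. F i x) (last_comps x)" for x
  define D where "D x h = join_comps (\<chi> i. F' i x h) (last_comps h)" for x h
  have dPhi: "(\<Phi> has_derivative D x) (at x)" if "x \<in> \<Omega>" for x
    unfolding \<Phi>_def D_def
  proof (rule has_derivative_join_comps)
    show "((\<lambda>x. \<chi> i. F i x) has_derivative (\<lambda>h. \<chi> i. F' i x h)) (at x)"
    proof (subst has_derivative_componentwise_within, intro ballI)
      fix b :: "real ^ 'l" assume "b \<in> Basis"
      then obtain c where b: "b = axis c 1" by (auto simp: Basis_vec_def)
      show "((\<lambda>x. (\<chi> i. F i x) \<bullet> b) has_derivative (\<lambda>h. (\<chi> i. F' i x h) \<bullet> b)) (at x)"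
        using F'(1)[OF that] by (simp add: b inner_axis)
    qed
    show "(last_comps has_derivative last_comps) (at x)"
      by (simp add: linear_last_comps linear_imp_has_derivative)
  qed
  have bl: "bounded_linear (D x)" if "x \<in> \<Omega>" for x
    using dPhi[OF that] by (rule has_derivative_bounded_linear)
  have "continuous_on \<Omega> (\<lambda>x. Blinfun (D x))"
  proof (rule continuous_on_blinfun_componentwise)
    fix b :: "real ^ ('l + 'm)"
    have "continuous_on \<Omega> (\<lambda>x. D x b)"
      unfolding D_def by (intro continuous_on_join_comps continuous_intros F')
    then show "continuous_on \<Omega> (\<lambda>x. blinfun_apply (Blinfun (D x)) b)"
      by (rule continuous_on_eq) (simp add: bounded_linear_Blinfun_apply bl)
  qed
  moreover have "linear (D z)" using bl[OF z(1)] by (rule bounded_linear.linear)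
  \<comment> \<open>A kernel vector is orthogonal to all gradients and has zero last components, so
    it is 0 by the uniqueness in \<open>ex1_vfield\<close> with \<open>s = 0\<close>.\<close>
  moreover have "inj (D z)"
    unfolding linear_injective_0[OF \<open>linear (D z)\<close>]
  proof (intro allI impI)
    fix h assume "D z h = 0"
    then have *: "first_comps (D z h) = 0" "last_comps (D z h) = 0"
      by (simp_all add: first_comps_def last_comps_def vec_eq_iff)
    then have "\<forall>i. h \<bullet> grad (F i) z = 0" "last_comps h = 0"
      using derivative_eq_grad[OF F'(1)[OF z(1)]] by (simp_all add: D_def vec_eq_iff)
    moreover have "last_comps 0 = 0" by (simp add: last_comps_def vec_eq_iff)
    ultimately show "h = 0" using ex1_vfield[OF z(3), of 0] by (metis inner_zero_left)
  qed
  then obtain G where G: "linear G" "G \<circ> D z = id"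
    using linear_injective_left_inverse[OF \<open>linear (D z)\<close>] by blast
  have "Blinfun G o\<^sub>L Blinfun (D z) = id_blinfun"
    using G by (intro blinfun_eqI)
      (simp add: bounded_linear_Blinfun_apply bl z linear_conv_bounded_linear[THEN iffD1] fun_eq_iff)
  ultimately obtain W V' g where W: "open W" "W \<subseteq> \<Omega>" "z \<in> W" "open V'" "homeomorphism W V' \<Phi> g"
    using inverse_function_theorem[of \<Omega> \<Phi> "\<lambda>x. Blinfun (D x)" z "Blinfun G"]
      \<Omega> z(1) dPhi by (metis bounded_linear_Blinfun_apply bl)
  \<comment> \<open>The slice of \<open>V'\<close> with zero first components, viewed in the space
    of last components, where it is open. On it \<open>g\<close> inverts
    \<open>last_comps\<close>.\<close>
  define U where "U = (\<lambda>u. join_comps 0 u) -` V'"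
  have cj: "continuous_on S (join_comps (0 :: real ^ 'l))" for S :: "(real ^ 'm) set"
      using continuous_on_join_comps[of S "\<lambda>_. 0" "\<lambda>u. u"] by (simp add: continuous_on_id continuous_on_const)
  have "homeomorphism (?Z \<inter> W) U last_comps (\<lambda>u. g (join_comps 0 u))"
  proof (rule homeomorphismI)
    show "continuous_on (?Z \<inter> W) last_comps"
      using linear_last_comps by (intro linear_continuous_on) (simp add: linear_conv_bounded_linear)
    show "continuous_on U (\<lambda>u. g (join_comps 0 u))"
      by (rule continuous_on_compose2[OF _ cj]) (use W(5) in \<open>auto simp: homeomorphism_def U_def\<close>)
    have Phi0: "\<Phi> x = join_comps 0 (last_comps x)" if "x \<in> ?Z" for x
      using that by (simp add: \<Phi>_def vec_eq_iff join_comps_def split: sum.split)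
    show "g (join_comps 0 (last_comps x)) = x" if "x \<in> ?Z \<inter> W" for x
      using that homeomorphism_apply1[OF W(5), of x] Phi0[of x] by simp
    show "last_comps ` (?Z \<inter> W) \<subseteq> U"
    proof (rule image_subsetI)
      fix x assume "x \<in> ?Z \<inter> W"
      moreover from this have "\<Phi> x \<in> V'" using W(5) unfolding homeomorphism_def by blast
      ultimately show "last_comps x \<in> U" using Phi0[of x] by (simp add: U_def)
    qed
    have *: "g (join_comps 0 u) \<in> W" "\<Phi> (g (join_comps 0 u)) = join_comps 0 u" if "u \<in> U" for u
      using that W(5) unfolding U_def homeomorphism_def by blast+
    show l: "last_comps (g (join_comps 0 u)) = u" if "u \<in> U" for u
      using *(2)[OF that] unfolding \<Phi>_def by (metis comps_simps(2))
    have "F i (g (join_comps 0 u)) = 0" if "u \<in> U" for i u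
      using arg_cong[OF *(2)[OF that], of first_comps] unfolding \<Phi>_def by (simp add: vec_eq_iff)
    then show "(\<lambda>u. g (join_comps 0 u)) ` U \<subseteq> ?Z \<inter> W"
      using * W(2) by auto
  qed
  moreover have "open U"
    unfolding U_def using W(4) cj[of UNIV] by (rule open_vimage)
  ultimately show ?thesis using W unfolding local_homeo_at_def by blast
qed

section \<open>The iterated flow as a continuous section over the parameter box\<close>

locale iterated_flow =
  fixes F :: "'l::finite \<Rightarrow> real ^ ('l + 'm::finite) \<Rightarrow> real"
    and \<Omega> V :: "(real ^ ('l + 'm)) set"
    and x0 :: "real ^ ('l + 'm)"
    and e :: "nat \<Rightarrow> 'm"
    and I :: "nat \<Rightarrow> real set"
    and y :: "nat \<Rightarrow> (nat \<Rightarrow> real) \<Rightarrow> real ^ ('l + 'm)"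
  assumes \<Omega>: "open \<Omega>" and C1: "\<And>k. C1_on \<Omega> (F k)"
    and x0: "\<And>k. F k x0 = 0" "x0 \<in> V"
    and V: "V \<subseteq> \<Omega>" "\<And>x. x \<in> V \<Longrightarrow> Delta F x \<noteq> 0"
    and e: "bij_betw e {1..CARD('m)} UNIV"
    and I: "\<And>j. j \<in> {1..CARD('m)} \<Longrightarrow> is_interval (I j) \<and> 0 \<in> I j"
    and sol: "iterated_solution F V x0 e I y"
begin

abbreviation "s0 \<equiv> last_comps x0"
abbreviation "Z \<equiv> {x \<in> \<Omega>. \<forall>k. F k x = 0}"

text \<open>Starting the iteration at \<open>j = 0\<close> with the constant \<open>x0\<close> turns the two kinds of initial
  condition into one.\<close>

definition y' :: "nat \<Rightarrow> (nat \<Rightarrow> real) \<Rightarrow> real ^ ('l + 'm)" where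
  "y' j t = (if j = 0 then x0 else y j t)"

text \<open>The times at which the flow should reach last components \<open>s\<close>, namely the
  formula of the theorem solved for \<open>t\<close>. The restricted abstraction makes the tuple
  extensional, as \<open>Pi\<^sub>E\<close> demands.\<close>

definition param :: "nat \<Rightarrow> real ^ 'm \<Rightarrow> nat \<Rightarrow> real" where
  "param j s = (\<lambda>i\<in>{1..j}. s $ e i - s0 $ e i)"

text \<open>A growing chain of faces, from the point \<open>s0\<close> at \<open>j = 0\<close> to
  the full shifted box at \<open>j = CARD('m)\<close>. All of them lie in the same space, so the
  single map \<open>Y\<close> can be studied on each.\<close>

definition box :: "nat \<Rightarrow> (real ^ 'm) set" where
  "box j = {s. \<forall>i\<in>{1..CARD('m)}. if i \<le> j then s $ e i - s0 $ e i \<in> I i else s $ e i = s0 $ e i}"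

definition Y :: "real ^ 'm \<Rightarrow> real ^ ('l + 'm)" where
  "Y s = y CARD('m) (param CARD('m) s)"

lemma e_eq_iff: "i \<in> {1..CARD('m)} \<Longrightarrow> j \<in> {1..CARD('m)} \<Longrightarrow> e i = e j \<longleftrightarrow> i = j"
  using inj_on_eq_iff[OF bij_betw_imp_inj_on[OF e]] .

lemma vec_eq_e: "s = s' \<longleftrightarrow> (\<forall>i\<in>{1..CARD('m)}. s $ e i = s' $ e i)" for s s' :: "'a ^ 'm"
proof -
  have "range (\<lambda>k::'m. k) = e ` {1..CARD('m)}" using e by (simp add: bij_betw_def)
  then show ?thesis unfolding vec_eq_iff by (metis UNIV_I imageE image_ident)
qed

lemma differentiable: "x \<in> \<Omega> \<Longrightarrow> F k differentiable at x"
  using C1[of k] unfolding C1_on_def differentiable_def by blast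

lemma upd_in_PiE:
  assumes "t \<in> Pi\<^sub>E {1..j} I" "\<tau> \<in> I (Suc j)"
  shows "t(Suc j := \<tau>) \<in> Pi\<^sub>E {1..Suc j} I"
  using assms by (auto simp: PiE_iff extensional_def le_Suc_eq)

lemma y'_step:
  assumes "j < CARD('m)" and t: "t \<in> Pi\<^sub>E {1..j} I"
  shows "y' (Suc j) (t(Suc j := 0)) = y' j t"
proof (cases "j = 0")
  case True
  have "t(Suc j := 0) \<in> Pi\<^sub>E {1..1} I"
    using upd_in_PiE[OF t, of 0] I[of 1] True assms by simp
  then show ?thesis using sol True unfolding iterated_solution_def y'_def by simp
next
  case False
  then have "Suc j \<in> {2..CARD('m)}" using assms by auto
  then have "y (Suc j) (t(Suc j := 0)) = y (Suc j - 1) t"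
    using sol t unfolding iterated_solution_def by (metis diff_Suc_1)
  then show ?thesis using False by (simp add: y'_def)
qed

lemma y'_flow:
  assumes "j < CARD('m)" and t: "t \<in> Pi\<^sub>E {1..j} I" and \<tau>: "\<tau> \<in> I (Suc j)"
  shows "y' (Suc j) (t(Suc j := \<tau>)) \<in> V"
    and "((\<lambda>\<tau>. y' (Suc j) (t(Suc j := \<tau>))) has_vector_derivative
          vfield F (e (Suc j)) (y' (Suc j) (t(Suc j := \<tau>)))) (at \<tau> within I (Suc j))"
proof -
  have "Suc j \<in> {1..CARD('m)}" using assms by auto
  from sol[unfolded iterated_solution_def, THEN conjunct1, rule_format, OF this upd_in_PiE[OF t \<tau>]]
  show "y' (Suc j) (t(Suc j := \<tau>)) \<in> V"
    "((\<lambda>\<tau>. y' (Suc j) (t(Suc j := \<tau>))) has_vector_derivative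
          vfield F (e (Suc j)) (y' (Suc j) (t(Suc j := \<tau>)))) (at \<tau> within I (Suc j))"
    by (simp_all add: y'_def)
qed

text \<open>Induction over the legs, using \<open>flow_line\<close> from time 0 on the last one.
  Coordinates numbered beyond \<open>j\<close> have not moved yet, hence the value 0 in the
  \<open>else\<close> branch. The argument is pointwise in \<open>t\<close> and involves no
  continuity in the parameters.\<close>

lemma y'_invariants:
  assumes "j \<le> CARD('m)" "t \<in> Pi\<^sub>E {1..j} I"
  shows "y' j t \<in> V \<and> (\<forall>k. F k (y' j t) = 0) \<and>
    (\<forall>i\<in>{1..CARD('m)}. last_comps (y' j t) $ e i = (if i \<le> j then t i else 0) + s0 $ e i)"
  using assms
proof (induction j arbitrary: t)
  case 0
  then show ?case using x0 by (simp add: y'_def)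
next
  case (Suc j)
  \<comment> \<open>Truncation makes the first \<open>j\<close> times an extensional tuple, the only
    kind on which stage \<open>j\<close> is specified. The last leg is then
    \<open>t'(Suc j := \<tau>)\<close> with \<tau> running from 0 to
    \<open>t (Suc j)\<close>.\<close>
  define t' where "t' = restrict t {1..j}"
  have t': "t' \<in> Pi\<^sub>E {1..j} I" using Suc.prems unfolding t'_def by auto
  have t'_nth: "t' i = t i" if "i \<in> {1..j}" for i using that by (simp add: t'_def)
  have t: "t = t'(Suc j := t (Suc j))" "t (Suc j) \<in> I (Suc j)"
    using Suc.prems unfolding t'_def by (auto simp: fun_eq_iff PiE_iff extensional_def restrict_def)
  let ?\<gamma> = "\<lambda>\<tau>. y' (Suc j) (t'(Suc j := \<tau>))"
  have jn: "j < CARD('m)" using Suc.prems by simp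
  have IJ: "is_interval (I (Suc j))" "0 \<in> I (Suc j)" using I[of "Suc j"] jn by auto
  note IH = Suc.IH[OF _ t'] y'_step[OF jn t']
  note flow = flow_line[where \<gamma> = ?\<gamma> and \<tau>\<^sub>0 = 0, OF IJ y'_flow(2)[OF jn t'] V(2)[OF y'_flow(1)[OF jn t']]
      differentiable[OF subsetD[OF V(1) y'_flow(1)[OF jn t']]] t(2)]
  have "F k (y' (Suc j) t) = 0" for k
    using flow(1)[of k] IH jn by (simp flip: t(1))
  moreover have L: "last_comps (y' (Suc j) t) = last_comps (y' j t') + t (Suc j) *\<^sub>R axis (e (Suc j)) 1"
    using flow(2) IH by (simp flip: t(1))
  have "last_comps (y' (Suc j) t) $ e i = (if i \<le> Suc j then t i else 0) + s0 $ e i"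
    if "i \<in> {1..CARD('m)}" for i
  proof -
    have "e i = e (Suc j) \<longleftrightarrow> i = Suc j" using that jn by (intro e_eq_iff) auto
    then show ?thesis using L that IH(1) jn t'_nth[of i] by (auto simp: axis_def le_Suc_eq)
  qed
  moreover have "y' (Suc j) t \<in> V" using y'_flow(1)[OF jn t' t(2)] by (simp flip: t(1))
  ultimately show ?case by blast
qed

text \<open>A frozen coordinate has offset 0, and 0 belongs to every \<open>I i\<close>.\<close>

lemma box_mono: "j \<le> k \<Longrightarrow> box j \<subseteq> box k"
proof
  fix s assume "j \<le> k" and s: "s \<in> box j"
  have "if i \<le> k then s $ e i - s0 $ e i \<in> I i else s $ e i = s0 $ e i" if i: "i \<in> {1..CARD('m)}" for i
    using s[unfolded box_def, THEN CollectD, THEN bspec, OF i] I[OF i] \<open>j \<le> k\<close>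
    by (auto split: if_splits)
  then show "s \<in> box k" by (simp add: box_def)
qed

lemma param_in_PiE: "s \<in> box j \<Longrightarrow> j \<le> CARD('m) \<Longrightarrow> param j s \<in> Pi\<^sub>E {1..j} I"
  unfolding box_def param_def by fastforce

text \<open>On \<open>box j\<close> all times after the \<open>j\<close>-th vanish, so the initial
  conditions collapse the later stages one by one.\<close>

lemma Y_eq:
  assumes "j \<le> CARD('m)" "s \<in> box j"
  shows "Y s = y' j (param j s)"
proof -
  have "y' k (param k s) = y' j (param j s)" if "j \<le> k" "k \<le> CARD('m)" for k
    using that
  proof (induction k rule: dec_induct)
    case (step k)
    have k: "Suc k \<in> {1..CARD('m)}" "\<not> Suc k \<le> j" using step by auto
    then have "s $ e (Suc k) = s0 $ e (Suc k)" using assms(2) unfolding box_def by fastforce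
    then have "param (Suc k) s = (param k s)(Suc k := 0)"
      by (auto simp: param_def fun_eq_iff restrict_def)
    moreover have "param k s \<in> Pi\<^sub>E {1..k} I"
      using step assms(2) box_mono[of j k] by (intro param_in_PiE) auto
    ultimately have "y' (Suc k) (param (Suc k) s) = y' k (param k s)"
      using y'_step[of k "param k s"] step.prems by (metis Suc_le_lessD)
    then show ?case using step by simp
  qed simp
  from this[of "CARD('m)"] show ?thesis using assms by (simp add: Y_def y'_def)
qed

lemma Y:
  assumes "s \<in> box CARD('m)"
  shows "Y s \<in> V" "F k (Y s) = 0" "last_comps (Y s) = s"
  using y'_invariants[OF order_refl param_in_PiE[OF assms]] assms
  by (auto simp: Y_eq[OF order_refl assms] vec_eq_e[of "last_comps _"] param_def)

lemma Y_base: "Y s0 = x0"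
proof -
  have "s0 \<in> box 0" by (simp add: box_def)
  from Y_eq[OF _ this] show ?thesis by (simp add: y'_def)
qed

lemma local_homeo_Y: "s \<in> box CARD('m) \<Longrightarrow> local_homeo_at Z last_comps (Y s)"
  using Y V by (intro local_homeo_level_set \<Omega> C1) auto

text \<open>Induction on the number of free coordinates. \<open>box (Suc j)\<close> is a product of
  \<open>box j\<close> with an interval; vertical lines are single legs of the flow, continuous
  because differentiable, and the slice at time 0 is \<open>Y\<close> on \<open>box j\<close>, so
  \<open>lift_continuous\<close> applies.\<close>

lemma continuous_on_Y: "j \<le> CARD('m) \<Longrightarrow> continuous_on (box j) Y"
proof (induction j)
  case 0
  have "box 0 = {s0}" by (auto simp: box_def vec_eq_e)
  then show ?case by simp
next
  case (Suc j)
  have j: "Suc j \<in> {1..CARD('m)}" "j \<le> CARD('m)" "j < CARD('m)" using Suc.prems by auto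
  let ?J = "I (Suc j)" and ?b = "axis (e (Suc j)) 1 :: real ^ 'm"
  \<comment> \<open>\<open>\<phi>\<close> identifies the product with \<open>box (Suc j)\<close>. It
    is also the map being lifted, because \<open>last_comps (Y s) = s\<close> on the box.\<close>
  define \<phi> where "\<phi> = (\<lambda>(a, \<tau>). a + \<tau> *\<^sub>R ?b)"
  have \<phi>: "\<phi> x \<in> box (Suc j)" if "x \<in> box j \<times> ?J" for x
    using that j by (auto simp: \<phi>_def box_def axis_def e_eq_iff le_Suc_eq)
  have \<phi>n: "\<phi> x \<in> box CARD('m)" if "x \<in> box j \<times> ?J" for x
    using \<phi>[OF that] box_mono[OF Suc.prems] by blast
  have cont\<phi>: "continuous_on A \<phi>" for A
    unfolding \<phi>_def by (simp add: case_prod_unfold) (intro continuous_intros)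
  have "continuous_on (box j \<times> ?J) (\<lambda>x. Y (\<phi> x))"
  proof (rule lift_continuous[where \<tau>\<^sub>0 = 0 and p = last_comps and Z = Z])
    show "is_interval ?J" "0 \<in> ?J" using I[OF j(1)] by auto
    show "continuous_on (box j \<times> ?J) \<phi>" by (rule cont\<phi>)
    show "(\<lambda>x. Y (\<phi> x)) ` (box j \<times> ?J) \<subseteq> Z" using Y \<phi>n V by blast
    show "local_homeo_at Z last_comps (Y (\<phi> x))" if "x \<in> box j \<times> ?J" for x
      using local_homeo_Y \<phi>n[OF that] by blast
    show "last_comps (Y (\<phi> x)) = \<phi> x" if "x \<in> box j \<times> ?J" for x
      using Y \<phi>n[OF that] by blast
    show "continuous_on ?J (\<lambda>\<tau>. Y (\<phi> (a, \<tau>)))" if a: "a \<in> box j" for a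
    proof -
      have "param (Suc j) (\<phi> (a, \<tau>)) = (param j a)(Suc j := \<tau>)" for \<tau>
      proof -
        have "a $ e (Suc j) = s0 $ e (Suc j)" using a j unfolding box_def by fastforce
        then show ?thesis using j
          by (auto simp: param_def \<phi>_def fun_eq_iff restrict_def axis_def e_eq_iff)
      qed
      then have "Y (\<phi> (a, \<tau>)) = y' (Suc j) ((param j a)(Suc j := \<tau>))" if "\<tau> \<in> ?J" for \<tau>
        using Y_eq[OF Suc.prems \<phi>[of "(a, \<tau>)"]] a that by simp
      moreover have "continuous_on ?J (\<lambda>\<tau>. y' (Suc j) ((param j a)(Suc j := \<tau>)))"
        by (rule continuous_on_vector_derivative) (rule y'_flow(2)[OF j(3) param_in_PiE[OF a j(2)]])
      ultimately show ?thesis by (metis (mono_tags, lifting) continuous_on_cong)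
    qed
    show "continuous_on (box j) (\<lambda>a. Y (\<phi> (a, 0)))"
      using Suc.IH j by (simp add: \<phi>_def)
  qed
  \<comment> \<open>\<open>\<psi>\<close> is the continuous inverse of \<open>\<phi>\<close>, which
    transfers continuity from the product back to \<open>box (Suc j)\<close>.\<close>
  moreover define \<psi> where
    "\<psi> s = (s - (s $ e (Suc j) - s0 $ e (Suc j)) *\<^sub>R ?b, s $ e (Suc j) - s0 $ e (Suc j))" for s
  have "continuous_on (box (Suc j)) \<psi>"
    unfolding \<psi>_def by (intro continuous_intros)
  moreover have "\<psi> ` box (Suc j) \<subseteq> box j \<times> ?J"
  proof (rule image_subsetI)
    fix s assume "s \<in> box (Suc j)"
    then have s: "if i \<le> Suc j then s $ e i - s0 $ e i \<in> I i else s $ e i = s0 $ e i"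
      if "i \<in> {1..CARD('m)}" for i using that unfolding box_def by blast
    have "if i \<le> j then fst (\<psi> s) $ e i - s0 $ e i \<in> I i else fst (\<psi> s) $ e i = s0 $ e i"
      if i: "i \<in> {1..CARD('m)}" for i
    proof (cases "i = Suc j")
      case True
      then show ?thesis by (simp add: \<psi>_def)
    next
      case False
      then have "fst (\<psi> s) $ e i = s $ e i" using e_eq_iff[OF i j(1)] by (simp add: \<psi>_def axis_def)
      then show ?thesis using s[OF i] False by (simp add: le_Suc_eq split: if_splits)
    qed
    then have "fst (\<psi> s) \<in> box j" unfolding box_def by blast
    moreover have "snd (\<psi> s) \<in> ?J" using s[OF j(1)] by (simp add: \<psi>_def)
    ultimately show "\<psi> s \<in> box j \<times> ?J" by (simp add: mem_Times_iff)
  qed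
  ultimately have "continuous_on (box (Suc j)) (\<lambda>s. Y (\<phi> (\<psi> s)))"
    by (rule continuous_on_compose2)
  then show ?case by (simp add: \<phi>_def \<psi>_def)
qed

section \<open>Existence and uniqueness of the implicit function\<close>

lemma convex_box: "convex (box CARD('m))"
proof (rule convexI)
  fix a b :: "real ^ 'm" and u v :: real
  assume ab: "a \<in> box CARD('m)" "b \<in> box CARD('m)" and uv: "0 \<le> u" "0 \<le> v" "u + v = 1"
  have "(u *\<^sub>R a + v *\<^sub>R b) $ e i - s0 $ e i \<in> I i" if i: "i \<in> {1..CARD('m)}" for i
  proof -
    have "u *\<^sub>R (a $ e i - s0 $ e i) + v *\<^sub>R (b $ e i - s0 $ e i) \<in> I i"
      using I[OF i] ab i uv unfolding box_def is_interval_convex_1 by (intro convexD) auto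
    also have "u *\<^sub>R (a $ e i - s0 $ e i) + v *\<^sub>R (b $ e i - s0 $ e i)
        = u * a $ e i + v * b $ e i - (u + v) * s0 $ e i"
      by (simp add: algebra_simps)
    finally show ?thesis using uv(3) by simp
  qed
  then show "u *\<^sub>R a + v *\<^sub>R b \<in> box CARD('m)" by (simp add: box_def)
qed

lemma box_n: "box CARD('m) = shifted_box e I s0"
  by (auto simp: box_def shifted_box_def)

lemma implicit_solution_Y: "implicit_solution F \<Omega> x0 (box CARD('m)) (\<lambda>s. first_comps (Y s))"
proof -
  have "join_comps (first_comps (Y s)) s = Y s" if "s \<in> box CARD('m)" for s
    using Y(3)[OF that] by (metis comps_simps(3))
  moreover have "continuous_on (box CARD('m)) (\<lambda>s. first_comps (Y s))"
    by (rule linear_continuous_on_compose[OF continuous_on_Y[OF order_refl] linear_first_comps])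
  ultimately show ?thesis
    using Y V Y_base unfolding implicit_solution_def by auto
qed

text \<open>The graph of \<open>g\<close> and \<open>Y\<close> are two lifts of the convex box that
  agree at \<open>s0\<close>. The graph is only known to lie in \<open>\<Omega>\<close>, possibly
  outside \<open>V\<close>; taking \<open>Y\<close> as the first map in \<open>lift_unique\<close>
  confines the local homeomorphism condition to points of \<open>V\<close>.\<close>

lemma implicit_solution_unique:
  assumes g: "implicit_solution F \<Omega> x0 (box CARD('m)) g" and s: "s \<in> box CARD('m)"
  shows "g s = first_comps (Y s)"
proof -
  have "s0 \<in> box CARD('m)" using I by (simp add: box_def)
  have "Y s = join_comps (g s) s"
  proof (rule lift_unique[where T = "box CARD('m)" and Z = Z and p = last_comps and a = s0])
    show "connected (box CARD('m))" by (intro convex_connected convex_box)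
    show "continuous_on (box CARD('m)) Y" by (simp add: continuous_on_Y)
    show "continuous_on (box CARD('m)) (\<lambda>s. join_comps (g s) s)"
      using g unfolding implicit_solution_def by (intro continuous_on_join_comps continuous_on_id) auto
    show "Y ` box CARD('m) \<subseteq> Z" using Y V by blast
    show "(\<lambda>s. join_comps (g s) s) ` box CARD('m) \<subseteq> Z" using g unfolding implicit_solution_def by blast
    show "Y s0 = join_comps (g s0) s0" using g Y_base unfolding implicit_solution_def by simp
  qed (use Y s \<open>s0 \<in> box CARD('m)\<close> local_homeo_Y in auto)
  then show ?thesis by simp
qed

end

theorem theorem6:
  fixes F :: "'l::finite \<Rightarrow> real ^ ('l + 'm::finite) \<Rightarrow> real"
    and \<Omega> V :: "(real ^ ('l + 'm)) set"
    and x0 :: "real ^ ('l + 'm)"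
    and e :: "nat \<Rightarrow> 'm"
    and I :: "nat \<Rightarrow> real set"
    and y :: "nat \<Rightarrow> (nat \<Rightarrow> real) \<Rightarrow> real ^ ('l + 'm)"
  assumes "open \<Omega>" and "connected \<Omega>" and "bounded \<Omega>" and "x0 \<in> \<Omega>"
    and "\<And>k. C1_on \<Omega> (F k)"
    and "\<And>k. F k x0 = 0"
    and "Delta F x0 \<noteq> 0"
    and "open V" and "x0 \<in> V" and "V \<subseteq> \<Omega>" and "\<And>x. x \<in> V \<Longrightarrow> Delta F x \<noteq> 0"
    and "bij_betw e {1..CARD('m)} UNIV"
    and "\<And>j. j \<in> {1..CARD('m)} \<Longrightarrow> is_interval (I j) \<and> closed (I j) \<and> 0 \<in> interior (I j)"
    and "iterated_solution F V x0 e I y"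
  shows "let n = CARD('m);
             S = shifted_box e I (last_comps x0);
             X = (\<lambda>s. first_comps (y n (\<lambda>j\<in>{1..n}. s $ e j - last_comps x0 $ e j)))
         in (\<forall>t\<in>Pi\<^sub>E {1..n} I. \<forall>j\<in>{1..n}.
               last_comps (y n t) $ e j = t j + last_comps x0 $ e j) \<and>
            implicit_solution F \<Omega> x0 S X \<and>
            (\<forall>g. implicit_solution F \<Omega> x0 S g \<longrightarrow> (\<forall>s\<in>S. g s = X s))"
proof -
  interpret iterated_flow F \<Omega> V x0 e I y
  proof unfold_locales
    show "is_interval (I j) \<and> 0 \<in> I j" if "j \<in> {1..CARD('m)}" for j
      using assms(13)[OF that] interior_subset[of "I j"] by blast
  qed (fact assms)+
  \<comment> \<open>At the final stage no coordinate is frozen, and \<open>y'\<close> coincides with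
    \<open>y\<close> since \<open>CARD('m)\<close> is positive.\<close>
  have "last_comps (y CARD('m) t) $ e j = t j + s0 $ e j"
    if "t \<in> Pi\<^sub>E {1..CARD('m)} I" "j \<in> {1..CARD('m)}" for t j
    using y'_invariants[OF order_refl that(1)] that(2) by (simp add: y'_def)
  then show ?thesis
    unfolding Let_def
    by (intro conjI ballI allI impI)
      (assumption | rule implicit_solution_Y[unfolded box_n Y_def param_def]
         implicit_solution_unique[unfolded box_n Y_def param_def])+
qed

end
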